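(* For any integer $m\ge 2$ and any path-connected ANR space $X$, $\mathsf{iTC}_m(X)\le\mathsf{dTC}_m(X)\le\mathsf{TC}_m(X)$.
   Context: $I=[0,1]$. For a metric space $Z$ and $n\ge 1$, $\mathcal B_n(Z)$ is the space of probability measures on $Z$ whose support has at most $n$ points, written as finite formal convex combinations $\sum\lambda_z z$ with $\lambda_z>0$, $\sum\lambda_z=1$, equipped with the Lévy–Prokhorov metric; $\delta_z$ is the Dirac measure at $z$. $P(Z)$ is the space of continuous paths $I\to Z$ with the compact-open topology. Define $\Phi_n:\mathcal B_n(P(X))\to P(\mathcal B_n(X))$ by $\Phi_n(\sum\lambda_\alpha\alpha)(t)=\sum\lambda_\alpha\alpha(t)$. A path $f\in P(\mathcal B_n(X))$ is resolvable if $f=\Phi_n(\mu)$ for some $\mu\in\mathcal B_n(P(X))$; $RP(\mathcal B_n(X))\subset P(\mathcal B_n(X))$ is the subspace of resolvable paths. Let $t_i=(i-1)/(m-1)$, $1\le i\le m$, and for $\overline x=(x_1,\dots,x_m)\in X^m$ let $P(\overline x)=\{\gamma\in P(X):\gamma(t_i)=x_i\text{ for all }i\}$. The following are minimal integers $n\ge0$ (infinite if none exists). $\mathsf{iTC}_m(X)$: minimal $n$ such that there is a continuous $s_m:X^m\to RP(\mathcal B_{n+1}(X))$ with $s_m(\overline x)(t_i)=\delta_{x_i}$ for all $i$ and $\overline x$. $\mathsf{dTC}_m(X)$: minimal $n$ such that there is a continuous $s_m:X^m\to\mathcal B_{n+1}(P(X))$ with $s_m(\overline x)\in\mathcal B_{n+1}(P(\overline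 x))$ for all $\overline x\in X^m$. $\mathsf{TC}_m(X)$: minimal $n$ such that $X^m$ is covered by $n+1$ open sets $V_i$, over each of which there is a continuous $s_i:V_i\to P(X)$ with $s_i(\overline x)(t_j)=x_j$ for all $\overline x\in V_i$, $1\le j\le m$. *)

theory Defs
  imports "HOL-Analysis.Analysis" "HOL-Probability.Probability_Mass_Function"
    "HOL-Library.Extended_Nat"
begin

section \<open>Path spaces\<close>

text \<open>Continuous maps are represented by their extensional representatives (value
  \<^term>\<open>undefined\<close> off the domain), so that distinct elements are distinct maps.\<close>

definition compact_open_topology :: "'a topology \<Rightarrow> 'b topology \<Rightarrow> ('a \<Rightarrow> 'b) topology" where
  "compact_open_topology X Y =
     topology_generated_by
       {{f. f \<in> extensional (topspace X) \<and> continuous_map X Y f \<and> f ` K \<subseteq> U} | K U.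
          compactin X K \<and> openin Y U}"

definition path_space :: "'a topology \<Rightarrow> (real \<Rightarrow> 'a) topology" where
  "path_space X = compact_open_topology (top_of_set {0..1}) X"

text \<open>The supremum metric, for which \<open>mtopology_of (path_metric X) = path_space (mtopology_of X)\<close>
  (lemma \<open>mtopology_of_path_metric\<close> below). It turns the path space of a metric space into a metric
  space, as is needed to form measures on it with the Levy--Prokhorov metric.\<close>

definition path_metric :: "'a metric \<Rightarrow> (real \<Rightarrow> 'a) metric" where
  "path_metric X = cfunspace (top_of_set {0..1}) X"

lemma topspace_compact_open_topology [simp]:
  "topspace (compact_open_topology X Y) =
     {f. f \<in> extensional (topspace X) \<and> continuous_map X Y f}"
  (is "_ = ?C")
proof
  show "topspace (compact_open_topology X Y) \<subseteq> ?C"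
    unfolding compact_open_topology_def topology_generated_by_topspace by blast
  have "compactin X {} \<and> openin Y {}" by simp
  then have "{f. f \<in> extensional (topspace X) \<and> continuous_map X Y f \<and> f ` {} \<subseteq> {}}
      \<subseteq> topspace (compact_open_topology X Y)"
    unfolding compact_open_topology_def topology_generated_by_topspace by (intro Union_upper) blast
  then show "?C \<subseteq> topspace (compact_open_topology X Y)" by simp
qed

lemma mtopology_of_cfunspace:
  assumes cpt: "compact_space X" and ne: "topspace X \<noteq> {}"
  shows "mtopology_of (cfunspace X m) = compact_open_topology X (mtopology_of m)"
proof -
  interpret M: Metric_space "mspace m" "mdist m" by simp
  interpret F: Metric_space "mspace (cfunspace X m)" "mdist (cfunspace X m)" by blast
  have cX: "compactin X (topspace X)"
    using cpt by (simp add: compact_space_def)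
  have C: "mspace (cfunspace X m) =
      {f. f \<in> extensional (topspace X) \<and> continuous_map X (mtopology_of m) f}"
    unfolding compactin_mspace_cfunspace [OF cX]
    using continuous_map_image_subset_topspace by fastforce
  have top: "mtopology_of m = M.mtopology" "mtopology_of (cfunspace X m) = F.mtopology"
    by (simp_all add: mtopology_of_def)
  have in_m: "f x \<in> mspace m" if "f \<in> mspace (cfunspace X m)" "x \<in> topspace X" for f x
    using that by auto
  have sub: "openin F.mtopology {f \<in> mspace (cfunspace X m). f ` K \<subseteq> U}"
    if K: "compactin X K" and U: "openin M.mtopology U" for K U
    unfolding F.openin_mtopology
  proof (intro conjI allI impI)
    fix f assume "f \<in> {f \<in> mspace (cfunspace X m). f ` K \<subseteq> U}"
    then have f: "f \<in> mspace (cfunspace X m)" "f ` K \<subseteq> U" by auto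
    then have "continuous_map X M.mtopology f" using C top by auto
    then have "compactin M.mtopology (f ` K)" using K image_compactin by blast
    then have "\<exists>e>0. \<forall>x \<in> f ` K. \<exists>V \<in> {U}. M.mball x e \<subseteq> V"
      unfolding M.compactin_sequentially
      by (intro M.Bolzano_Weierstrass_D) (use f U in auto)
    then obtain e where e: "e > 0" "\<And>x. x \<in> K \<Longrightarrow> M.mball (f x) e \<subseteq> U" by auto
    have KX: "K \<subseteq> topspace X" using K compactin_subset_topspace by blast
    have "F.mball f e \<subseteq> {f \<in> mspace (cfunspace X m). f ` K \<subseteq> U}"
    proof (clarify, intro CollectI conjI)
      fix g assume g: "g \<in> F.mball f e"
      then show gm: "g \<in> mspace (cfunspace X m)" by (simp only: F.in_mball)
      have "mdist m (f x) (g x) < e" if "x \<in> K" for x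
        using cfunspace_mdist_lt [OF cX f(1) gm] g that KX by (auto simp only: F.in_mball)
      then show "g ` K \<subseteq> U"
        using e(2) in_m [OF gm] in_m [OF f(1)] KX by (fastforce simp: subset_iff)
    qed
    with e(1) show "\<exists>r>0. F.mball f r \<subseteq> {f \<in> mspace (cfunspace X m). f ` K \<subseteq> U}" by blast
  qed auto
  let ?S = "{{f. f \<in> extensional (topspace X) \<and> continuous_map X (mtopology_of m) f \<and> f ` K \<subseteq> U} | K U.
          compactin X K \<and> openin (mtopology_of m) U}"
  have S_eq: "{f. f \<in> extensional (topspace X) \<and> continuous_map X (mtopology_of m) f \<and> f ` K \<subseteq> U}
      = {f \<in> mspace (cfunspace X m). f ` K \<subseteq> U}" for K U
    unfolding C by auto
  have le: "openin F.mtopology W" if "generate_topology_on ?S W" for W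
    using that
  proof induction
    case (Basis s)
    then obtain K U where "compactin X K" "openin M.mtopology U"
      and s: "s = {f \<in> mspace (cfunspace X m). f ` K \<subseteq> U}"
      unfolding S_eq mem_Collect_eq by (metis top(1))
    then show ?case using sub unfolding s by blast
  next
    case (Int a b)
    then show ?case by (intro openin_Int)
  next
    case (UN K)
    then show ?case by (intro openin_Union) blast
  qed simp
  have ge: "openin (compact_open_topology X (mtopology_of m)) W" if W: "openin F.mtopology W" for W
  proof (subst openin_subopen, intro ballI)
    fix f assume fW: "f \<in> W"
    then have f: "f \<in> mspace (cfunspace X m)" using W F.openin_mtopology by auto
    obtain r where r: "r > 0" "F.mball f r \<subseteq> W"
      using W fW unfolding F.openin_mtopology by blast
    have cf: "continuous_map X M.mtopology f" using C f top by auto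
    define K where "K t = {x \<in> topspace X. f x \<in> M.mcball (f t) (r/4)}" for t
    define V where "V t = {x \<in> topspace X. f x \<in> M.mball (f t) (r/4)}" for t
    have Kc: "compactin X (K t)" for t
      unfolding K_def using cf cpt
      by (intro closedin_compact_space closedin_continuous_map_preimage [OF cf]) auto
    have Vo: "openin X (V t)" for t
      unfolding V_def by (intro openin_continuous_map_preimage [OF cf]) auto
    have "topspace X \<subseteq> \<Union>(V ` topspace X)"
      using r(1) in_m [OF f] by (auto simp: V_def)
    moreover have "\<forall>U \<in> V ` topspace X. openin X U" using Vo by blast
    ultimately obtain D where D: "finite D" "D \<subseteq> V ` topspace X" "topspace X \<subseteq> \<Union>D"
      using cX unfolding compactin_def by meson
    then obtain T where T: "finite T" "T \<subseteq> topspace X" "topspace X \<subseteq> \<Union>(V ` T)"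
      by (metis finite_subset_image)
    define N where "N t = {g \<in> mspace (cfunspace X m). g ` K t \<subseteq> M.mball (f t) (r/2)}" for t
    have No: "openin (compact_open_topology X (mtopology_of m)) (N t)" for t
    proof -
      have "openin (mtopology_of m) (M.mball (f t) (r/2))"
        unfolding top by (rule M.openin_mball)
      then have "N t \<in> ?S" unfolding N_def S_eq using Kc by blast
      then show ?thesis
        unfolding compact_open_topology_def by (rule topology_generated_by_Basis)
    qed
    have "T \<noteq> {}" using T ne by auto
    then have "openin (compact_open_topology X (mtopology_of m)) (\<Inter>(N ` T))"
      using No T(1) by (intro openin_Inter) auto
    moreover have "f \<in> \<Inter>(N ` T)"
      using f r(1) in_m [OF f] by (auto simp: N_def K_def)
    moreover have "\<Inter>(N ` T) \<subseteq> W"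
    proof
      fix g assume gN: "g \<in> \<Inter>(N ` T)"
      then have g: "g \<in> mspace (cfunspace X m)" using \<open>T \<noteq> {}\<close> by (auto simp only: N_def)
      have "mdist m (f x) (g x) \<le> 3 * r/4" if x: "x \<in> topspace X" for x
      proof -
        obtain t where t: "t \<in> T" "x \<in> V t" using T x by blast
        then have "x \<in> K t" by (auto simp: V_def K_def)
        moreover have "g ` K t \<subseteq> M.mball (f t) (r/2)" using gN t(1) unfolding N_def by blast
        ultimately have "mdist m (f t) (g x) < r/2" by auto
        moreover have "mdist m (f t) (f x) < r/4" using t by (auto simp: V_def)
        moreover have "mdist m (f x) (g x) \<le> mdist m (f x) (f t) + mdist m (f t) (g x)"
          using in_m [OF f] in_m [OF g] t T x by (intro mdist_triangle) auto
        ultimately show ?thesis by (simp add: mdist_commute)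
      qed
      then have "mdist (cfunspace X m) f g \<le> 3 * r/4"
        using cfunspace_mdist_le [OF f g ne] by blast
      then have "g \<in> F.mball f r" using f g r(1) by (simp only: F.in_mball) auto
      then show "g \<in> W" using r by blast
    qed
    ultimately show "\<exists>T. openin (compact_open_topology X (mtopology_of m)) T \<and> f \<in> T \<and> T \<subseteq> W"
      by blast
  qed
  show ?thesis
    unfolding topology_eq top(2)
    using le ge openin_topology_generated_by unfolding compact_open_topology_def by blast
qed

lemma mtopology_of_path_metric:
  "mtopology_of (path_metric X) = path_space (mtopology_of X)"
  unfolding path_metric_def path_space_def
  by (intro mtopology_of_cfunspace) (auto simp: compact_space_subtopology)


section \<open>Probability measures with finite support\<close>

text \<open>A measure \<open>\<Sum> \<lambda>\<^sub>z z\<close> with finite support is the pmf \<open>\<mu>\<close> with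
  \<open>pmf \<mu> z = \<lambda>\<^sub>z\<close>; its support is \<^term>\<open>set_pmf \<mu>\<close>.\<close>

definition enlargement :: "'a metric \<Rightarrow> 'a set \<Rightarrow> real \<Rightarrow> 'a set" where
  "enlargement Z A e = (\<Union>a\<in>A. mball_of Z a e)"

definition borel_sets_of :: "'a topology \<Rightarrow> 'a set set" where
  "borel_sets_of X = sigma_sets (topspace X) {U. openin X U}"

definition levy_prokhorov :: "'a metric \<Rightarrow> 'a pmf \<Rightarrow> 'a pmf \<Rightarrow> real" where
  "levy_prokhorov Z \<mu> \<nu> =
     Inf {e. e > 0 \<and> (\<forall>A \<in> borel_sets_of (mtopology_of Z).
            measure_pmf.prob \<mu> A \<le> measure_pmf.prob \<nu> (enlargement Z A e) + e \<and>
            measure_pmf.prob \<nu> A \<le> measure_pmf.prob \<mu> (enlargement Z A e) + e)}"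

definition fin_measures :: "nat \<Rightarrow> 'a metric \<Rightarrow> 'a pmf set" where
  "fin_measures n Z = {\<mu>. set_pmf \<mu> \<subseteq> mspace Z \<and> finite (set_pmf \<mu>) \<and> card (set_pmf \<mu>) \<le> n}"

definition fin_measure_space :: "nat \<Rightarrow> 'a metric \<Rightarrow> 'a pmf metric" where
  "fin_measure_space n Z = metric (fin_measures n Z, levy_prokhorov Z)"

lemma Metric_space_levy_prokhorov: "Metric_space (fin_measures n Z) (levy_prokhorov Z)"
proof -
  interpret Z: Metric_space "mspace Z" "mdist Z" by simp
  let ?B = "borel_sets_of (mtopology_of Z)"
  define L where "L \<mu> \<nu> = {e. e > 0 \<and> (\<forall>A \<in> ?B.
            measure_pmf.prob \<mu> A \<le> measure_pmf.prob \<nu> (enlargement Z A e) + e \<and>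
            measure_pmf.prob \<nu> A \<le> measure_pmf.prob \<mu> (enlargement Z A e) + e)}" for \<mu> \<nu> :: "'a pmf"
  have LP: "levy_prokhorov Z \<mu> \<nu> = Inf (L \<mu> \<nu>)" for \<mu> \<nu>
    by (simp add: levy_prokhorov_def L_def)
  have one: "1 \<in> L \<mu> \<nu>" for \<mu> \<nu>
    by (auto simp: L_def intro: order_trans [OF measure_pmf.prob_le_1])
  have pos: "e > 0" if "e \<in> L \<mu> \<nu>" for e \<mu> \<nu> using that by (simp add: L_def)
  have bdd: "bdd_below (L \<mu> \<nu>)" for \<mu> \<nu>
    by (rule bdd_belowI [of _ 0]) (simp add: pos less_imp_le)
  have open_B: "U \<in> ?B" if "openin (mtopology_of Z) U" for U
    using that by (simp add: borel_sets_of_def)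
  have sing_B: "{x} \<in> ?B" if "x \<in> mspace Z" for x
  proof -
    have "closedin (mtopology_of Z) {x}"
      using that Z.Hausdorff_space_mtopology
      by (simp add: mtopology_of_def closedin_Hausdorff_sing_eq)
    then have "topspace (mtopology_of Z) - {x} \<in> ?B" by (intro open_B openin_diff openin_topspace)
    then have "topspace (mtopology_of Z) - (topspace (mtopology_of Z) - {x}) \<in> ?B"
      unfolding borel_sets_of_def by (rule sigma_sets.Compl)
    then show ?thesis using that by (simp add: Diff_Diff_Int Int_absorb1)
  qed
  have enl_B: "enlargement Z A e \<in> ?B" for A e
    unfolding enlargement_def by (intro open_B openin_Union) (auto simp: mtopology_of_def mball_of_def)
  have nonneg: "0 \<le> levy_prokhorov Z \<mu> \<nu>" for \<mu> \<nu>
    unfolding LP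
  proof (rule cInf_greatest)
    show "L \<mu> \<nu> \<noteq> {}" using one by blast
    show "0 \<le> e" if "e \<in> L \<mu> \<nu>" for e using pos [OF that] by simp
  qed
  have refl: "levy_prokhorov Z \<mu> \<mu> = 0" if "\<mu> \<in> fin_measures n Z" for \<mu>
  proof -
    have in_L: "e \<in> L \<mu> \<mu>" if e: "e > 0" for e
    proof -
      have "measure_pmf.prob \<mu> A \<le> measure_pmf.prob \<mu> (enlargement Z A e) + e" if A: "A \<in> ?B" for A
      proof -
        have "A \<subseteq> mspace Z"
          using A sigma_sets_into_sp [of "{U. openin (mtopology_of Z) U}" "mspace Z"] openin_subset
          unfolding borel_sets_of_def by fastforce
        then have "A \<subseteq> enlargement Z A e" using e by (force simp: enlargement_def)
        then have "measure_pmf.prob \<mu> A \<le> measure_pmf.prob \<mu> (enlargement Z A e)"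
          by (intro measure_pmf.finite_measure_mono) auto
        with e show ?thesis by simp
      qed
      then show ?thesis using e by (simp add: L_def)
    qed
    have "levy_prokhorov Z \<mu> \<mu> \<le> e" if "e > 0" for e
      unfolding LP using in_L [OF that] bdd by (rule cInf_lower)
    then have "levy_prokhorov Z \<mu> \<mu> \<le> 0"
      using field_le_epsilon [of "levy_prokhorov Z \<mu> \<mu>" 0] by simp
    with nonneg [of \<mu> \<mu>] show ?thesis by simp
  qed
  have pmf_le: "pmf \<mu> x \<le> pmf \<nu> x"
    if \<mu>: "\<mu> \<in> fin_measures n Z" and \<nu>: "\<nu> \<in> fin_measures n Z"
      and 0: "levy_prokhorov Z \<mu> \<nu> = 0" for \<mu> \<nu> x
  proof (rule ccontr)
    assume "\<not> ?thesis"
    then have gt: "pmf \<mu> x > pmf \<nu> x" by simp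
    then have "x \<in> set_pmf \<mu>" by (metis pmf_nonneg not_le set_pmf_iff)
    then have x: "x \<in> mspace Z" using \<mu> by (auto simp: fin_measures_def)
    have fin: "finite (set_pmf \<nu>)" and sub: "set_pmf \<nu> \<subseteq> mspace Z"
      using \<nu> by (auto simp: fin_measures_def)
    define D where "D = insert (pmf \<mu> x - pmf \<nu> x) (mdist Z x ` (set_pmf \<nu> - {x}))"
    have D: "finite D" "D \<noteq> {}" "\<And>r. r \<in> D \<Longrightarrow> r > 0"
      using fin gt sub x Z.mdist_pos_less by (auto simp: D_def)
    then have "Min D > 0" by simp
    then have "Inf (L \<mu> \<nu>) < Min D" using 0 by (simp add: LP)
    then obtain e where e: "e \<in> L \<mu> \<nu>" "e < Min D"
      using cInf_lessD [of "L \<mu> \<nu>" "Min D"] one by blast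
    have eD: "e < r" if "r \<in> D" for r
      using e(2) Min_le [OF D(1) that] by linarith
    have "enlargement Z {x} e \<inter> set_pmf \<nu> \<subseteq> {x}"
    proof
      fix y assume y: "y \<in> enlargement Z {x} e \<inter> set_pmf \<nu>"
      then have "\<not> e < mdist Z x y" by (simp add: enlargement_def)
      then have "mdist Z x y \<notin> D" using eD by blast
      then show "y \<in> {x}" using y by (auto simp: D_def)
    qed
    then have "measure_pmf.prob \<nu> (enlargement Z {x} e) \<le> measure_pmf.prob \<nu> {x}"
      using measure_pmf.finite_measure_mono [of "enlargement Z {x} e \<inter> set_pmf \<nu>" "{x}" \<nu>]
      by (simp add: measure_Int_set_pmf)
    moreover have "measure_pmf.prob \<mu> {x} \<le> measure_pmf.prob \<nu> (enlargement Z {x} e) + e"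
      using e(1) sing_B [OF x] by (auto simp: L_def)
    moreover have "e < pmf \<mu> x - pmf \<nu> x" by (rule eD) (simp add: D_def)
    ultimately show False by (simp add: measure_pmf_single)
  qed
  have sym: "levy_prokhorov Z \<mu> \<nu> = levy_prokhorov Z \<nu> \<mu>" for \<mu> \<nu>
    unfolding levy_prokhorov_def by (rule arg_cong [where f = Inf]) blast
  show ?thesis
  proof
    show "0 \<le> levy_prokhorov Z \<mu> \<nu>" for \<mu> \<nu>
      by (rule nonneg)
    show "levy_prokhorov Z \<mu> \<nu> = levy_prokhorov Z \<nu> \<mu>" for \<mu> \<nu>
      by (rule sym)
    show "levy_prokhorov Z \<mu> \<nu> = 0 \<longleftrightarrow> \<mu> = \<nu>"
      if "\<mu> \<in> fin_measures n Z" "\<nu> \<in> fin_measures n Z" for \<mu> \<nu>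
      using refl [of \<mu>] pmf_le [of \<mu> \<nu>] pmf_le [of \<nu> \<mu>] that sym [of \<mu> \<nu>]
      by (auto intro!: pmf_eqI order_antisym)
    show "levy_prokhorov Z \<mu> \<rho> \<le> levy_prokhorov Z \<mu> \<nu> + levy_prokhorov Z \<nu> \<rho>"
      if "\<mu> \<in> fin_measures n Z" "\<nu> \<in> fin_measures n Z" "\<rho> \<in> fin_measures n Z" for \<mu> \<nu> \<rho>
    proof -
      have enl: "enlargement Z (enlargement Z A e) e' \<subseteq> enlargement Z A (e + e')" for A e e'
      proof
        fix z assume "z \<in> enlargement Z (enlargement Z A e) e'"
        then obtain x y where "x \<in> A" and m: "x \<in> mspace Z" "y \<in> mspace Z" "z \<in> mspace Z"
          and d: "mdist Z x y < e" "mdist Z y z < e'"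
          by (auto simp: enlargement_def)
        have "mdist Z x z < e + e'" using mdist_triangle [OF m] d by linarith
        with \<open>x \<in> A\<close> m show "z \<in> enlargement Z A (e + e')"
          by (auto simp: enlargement_def)
      qed
      have enl2: "enlargement Z (enlargement Z A e') e \<subseteq> enlargement Z A (e + e')" for A e e'
        using enl [of A e' e] by (simp add: add.commute)
      have add: "e + e' \<in> L \<mu> \<rho>" if e: "e \<in> L \<mu> \<nu>" "e' \<in> L \<nu> \<rho>" for e e'
      proof -
        have "measure_pmf.prob \<mu> A \<le> measure_pmf.prob \<rho> (enlargement Z A (e + e')) + (e + e')"
          if A: "A \<in> ?B" for A
        proof -
          have "measure_pmf.prob \<mu> A \<le> measure_pmf.prob \<nu> (enlargement Z A e) + e"
            using e A by (auto simp: L_def)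
          also have "measure_pmf.prob \<nu> (enlargement Z A e)
              \<le> measure_pmf.prob \<rho> (enlargement Z (enlargement Z A e) e') + e'"
            using e enl_B by (auto simp: L_def)
          also have "measure_pmf.prob \<rho> (enlargement Z (enlargement Z A e) e')
              \<le> measure_pmf.prob \<rho> (enlargement Z A (e + e'))"
            using enl by (intro measure_pmf.finite_measure_mono) auto
          finally show ?thesis by simp
        qed
        moreover have "measure_pmf.prob \<rho> A \<le> measure_pmf.prob \<mu> (enlargement Z A (e + e')) + (e + e')"
          if A: "A \<in> ?B" for A
        proof -
          have "measure_pmf.prob \<rho> A \<le> measure_pmf.prob \<nu> (enlargement Z A e') + e'"
            using e A by (auto simp: L_def)
          also have "measure_pmf.prob \<nu> (enlargement Z A e')
              \<le> measure_pmf.prob \<mu> (enlargement Z (enlargement Z A e') e) + e"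
            using e enl_B by (auto simp: L_def)
          also have "measure_pmf.prob \<mu> (enlargement Z (enlargement Z A e') e)
              \<le> measure_pmf.prob \<mu> (enlargement Z A (e + e'))"
            using enl2 by (intro measure_pmf.finite_measure_mono) auto
          finally show ?thesis by simp
        qed
        ultimately show ?thesis using pos e by (simp add: L_def add_pos_pos)
      qed
      have ne: "L \<alpha> \<beta> \<noteq> {}" for \<alpha> \<beta> using one by blast
      have "Inf (L \<mu> \<rho>) - e' \<le> Inf (L \<mu> \<nu>)" if e': "e' \<in> L \<nu> \<rho>" for e'
      proof (rule cInf_greatest [OF ne])
        fix e assume "e \<in> L \<mu> \<nu>"
        then show "Inf (L \<mu> \<rho>) - e' \<le> e" using cInf_lower [OF add [OF _ e'] bdd] by fastforce
      qed
      then have "Inf (L \<mu> \<rho>) - Inf (L \<mu> \<nu>) \<le> Inf (L \<nu> \<rho>)"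
        by (intro cInf_greatest [OF ne]) (simp add: algebra_simps)
      then show ?thesis by (simp add: LP)
    qed
  qed
qed

lemma mspace_fin_measure_space [simp]: "mspace (fin_measure_space n Z) = fin_measures n Z"
  and mdist_fin_measure_space [simp]: "mdist (fin_measure_space n Z) = levy_prokhorov Z"
  by (simp_all add: fin_measure_space_def Metric_space_levy_prokhorov
      Metric_space.mspace_metric Metric_space.mdist_metric)


section \<open>Resolvable paths\<close>

text \<open>\<open>\<Phi>\<^sub>n(\<Sum> \<lambda>\<^sub>\<alpha> \<alpha>)(t) = \<Sum> \<lambda>\<^sub>\<alpha> \<alpha>(t)\<close> is the push-forward under evaluation at \<open>t\<close>.\<close>

definition resolve :: "(real \<Rightarrow> 'a) pmf \<Rightarrow> real \<Rightarrow> 'a pmf" where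
  "resolve \<mu> = (\<lambda>t\<in>{0..1}. map_pmf (\<lambda>\<alpha>. \<alpha> t) \<mu>)"

definition resolvable_paths :: "nat \<Rightarrow> 'a metric \<Rightarrow> (real \<Rightarrow> 'a pmf) set" where
  "resolvable_paths n X =
     {f \<in> topspace (path_space (mtopology_of (fin_measure_space n X))).
        \<exists>\<mu> \<in> mspace (fin_measure_space n (path_metric X)). f = resolve \<mu>}"

definition resolvable_path_space :: "nat \<Rightarrow> 'a metric \<Rightarrow> (real \<Rightarrow> 'a pmf) topology" where
  "resolvable_path_space n X =
     subtopology (path_space (mtopology_of (fin_measure_space n X))) (resolvable_paths n X)"


section \<open>Sequential topological complexities\<close>

definition power_space :: "nat \<Rightarrow> 'a topology \<Rightarrow> (nat \<Rightarrow> 'a) topology" where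
  "power_space m X = product_topology (\<lambda>_. X) {1..m}"

definition stop_time :: "nat \<Rightarrow> nat \<Rightarrow> real" where
  "stop_time m i = (real i - 1) / (real m - 1)"

definition paths_through :: "nat \<Rightarrow> 'a metric \<Rightarrow> (nat \<Rightarrow> 'a) \<Rightarrow> (real \<Rightarrow> 'a) set" where
  "paths_through m X x =
     {\<gamma> \<in> topspace (path_space (mtopology_of X)). \<forall>i\<in>{1..m}. \<gamma> (stop_time m i) = x i}"

text \<open>\<^typ>\<open>enat\<close> is a complete lattice in which the infimum of a nonempty set is its minimum and
  that of the empty set is \<open>\<infinity>\<close>.\<close>

definition iTC :: "nat \<Rightarrow> 'a metric \<Rightarrow> enat" where
  "iTC m X = Inf {enat n | n. \<exists>s.
     continuous_map (power_space m (mtopology_of X)) (resolvable_path_space (n + 1) X) s \<and>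
     (\<forall>x \<in> topspace (power_space m (mtopology_of X)). \<forall>i\<in>{1..m}.
        s x (stop_time m i) = return_pmf (x i))}"

definition dTC :: "nat \<Rightarrow> 'a metric \<Rightarrow> enat" where
  "dTC m X = Inf {enat n | n. \<exists>s.
     continuous_map (power_space m (mtopology_of X))
       (mtopology_of (fin_measure_space (n + 1) (path_metric X))) s \<and>
     (\<forall>x \<in> topspace (power_space m (mtopology_of X)).
        s x \<in> mspace (fin_measure_space (n + 1) (submetric (path_metric X) (paths_through m X x))))}"

definition TC :: "nat \<Rightarrow> 'a topology \<Rightarrow> enat" where
  "TC m X = Inf {enat n | n. \<exists>V :: nat \<Rightarrow> (nat \<Rightarrow> 'a) set.
     (\<forall>i\<le>n. openin (power_space m X) (V i)) \<and>
     topspace (power_space m X) = (\<Union>i\<le>n. V i) \<and>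
     (\<forall>i\<le>n. \<exists>s. continuous_map (subtopology (power_space m X) (V i)) (path_space X) s \<and>
        (\<forall>x \<in> V i. \<forall>j\<in>{1..m}. s x (stop_time m j) = x j))}"


section \<open>Absolute neighbourhood retracts\<close>

text \<open>A metrizable space is an ANR if it is a neighbourhood retract of every metrizable space
  containing it as a closed subspace. HOL cannot quantify over types inside a definition, so the
  ambient spaces \<open>Y\<close> range over all metrizable topologies on subsets of \<^typ>\<open>'a \<Rightarrow> real\<close>.
  This loses nothing: by Kuratowski and Wojdyslawski, \<open>X\<close> embeds in the Banach space of bounded
  continuous functions \<open>X \<rightarrow> \<real>\<close> as a closed subset of its convex hull \<open>C\<close>, which is
  metrizable and carried by \<^typ>\<open>'a \<Rightarrow> real\<close>; and by Dugundji's extension theorem a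
  neighbourhood retract of \<open>C\<close> is an ANR for ambient spaces of any type. The library predicate
  \<^const>\<open>ANR\<close> is not used because its ambient spaces are subsets of \<^typ>\<open>'a \<times> real\<close>, which
  is adequate only for subsets of Euclidean spaces.\<close>

definition ANR_space :: "'a topology \<Rightarrow> bool" where
  "ANR_space X \<longleftrightarrow> metrizable_space X \<and>
     (\<forall>(Y :: ('a \<Rightarrow> real) topology) A.
        metrizable_space Y \<and> closedin Y A \<and> X homeomorphic_space subtopology Y A \<longrightarrow>
        (\<exists>U. openin Y U \<and> A \<subseteq> U \<and> A retract_of_space subtopology Y U))"

end

theory Submission
  imports Defs
begin

text \<open>
  For the first inequality, \<open>\<Phi>\<close> (\<^const>\<open>resolve\<close>) is continuous, so that it turns a section
  that witnesses \<open>dTC\<close> into one that witnesses \<open>iTC\<close>. In fact \<open>\<Phi>\<close> is 1-Lipschitz: for the supremum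
  metric on paths, evaluation at a time \<open>t\<close> does not increase distances, hence neither does the
  push-forward of measures under it (\<open>levy_prokhorov_map_pmf_nonexpansive\<close>), and the distance of
  the paths \<open>\<Phi>(\<mu>)\<close> and \<open>\<Phi>(\<nu>)\<close> is the supremum over \<open>t\<close> of these distances. At a stop time
  all paths in the support of the given measure pass through the same point \<open>x\<^sub>i\<close>, so that the
  push-forward is \<open>\<delta>\<close> at \<open>x\<^sub>i\<close>.

  For the second inequality, let \<open>s\<^sub>i\<close> be local sections over the members \<open>V\<^sub>i\<close> of an open cover of
  \<open>X\<^sup>m\<close>. This space is metrizable, so there is a partition of unity \<open>w\<^sub>i\<close> with \<open>w\<^sub>i > 0\<close> exactly on
  \<open>V\<^sub>i\<close> (\<open>metrizable_space_partition_of_unity\<close>). Then \<open>x \<mapsto> \<Sum> w\<^sub>i(x) s\<^sub>i(x)\<close>, where the sum is over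
  those \<open>i\<close> with \<open>x \<in> V\<^sub>i\<close>, is a global section with values in measures on the paths
  through \<open>x\<close>. It is continuous although \<open>s\<^sub>i\<close> may oscillate near the boundary of \<open>V\<^sub>i\<close>: there its
  weight is small, and a small mass may be moved arbitrarily far at a small Levy--Prokhorov cost
  (\<open>continuous_map_mixture\<close>).

  The continuity of each resolved path \<open>t \<mapsto> \<Sum> \<lambda>\<^sub>\<alpha> \<alpha>(t)\<close> is another instance of
  \<open>continuous_map_mixture\<close>, with constant weights.
\<close>

section \<open>Estimates for the Levy--Prokhorov metric\<close>

lemma finite_in_borel_sets_of:
  assumes "finite A" "A \<subseteq> mspace Z"
  shows "A \<in> borel_sets_of (mtopology_of Z)"
proof -
  interpret Z: Metric_space "mspace Z" "mdist Z" by simp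
  have "closedin (mtopology_of Z) A"
    using assms by (intro compactin_imp_closedin finite_imp_compactin)
      (simp_all add: mtopology_of_def Z.Hausdorff_space_mtopology)
  then have "topspace (mtopology_of Z) - A \<in> borel_sets_of (mtopology_of Z)"
    unfolding borel_sets_of_def closedin_def by (intro sigma_sets.Basic) blast
  then have "topspace (mtopology_of Z) - (topspace (mtopology_of Z) - A) \<in> borel_sets_of (mtopology_of Z)"
    unfolding borel_sets_of_def by (rule sigma_sets.Compl)
  then show ?thesis using assms by (simp add: Diff_Diff_Int Int_absorb1)
qed

lemma in_enlargement_iff:
  "z \<in> enlargement Z A e \<longleftrightarrow> (\<exists>a\<in>A. a \<in> mspace Z \<and> z \<in> mspace Z \<and> mdist Z a z < e)"
  by (auto simp: enlargement_def)

lemma borel_sets_of_subset: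
  assumes "A \<in> borel_sets_of X"
  shows "A \<subseteq> topspace X"
  using assms sigma_sets_into_sp [of "{U. openin X U}" "topspace X"] openin_subset
  unfolding borel_sets_of_def by fastforce

lemma levy_prokhorov_le:
  assumes "e > 0"
    and "\<And>A. A \<subseteq> mspace Z \<Longrightarrow>
      measure_pmf.prob \<mu> A \<le> measure_pmf.prob \<nu> (enlargement Z A e) + e"
    and "\<And>A. A \<subseteq> mspace Z \<Longrightarrow>
      measure_pmf.prob \<nu> A \<le> measure_pmf.prob \<mu> (enlargement Z A e) + e"
  shows "levy_prokhorov Z \<mu> \<nu> \<le> e"
  unfolding levy_prokhorov_def
  by (rule cInf_lower)
    (use assms in \<open>auto intro!: bdd_belowI [of _ 0] dest: borel_sets_of_subset\<close>)

text \<open>Both measures are indexed by one weighted set, which couples them: the mass that \<open>p\<close> and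
  \<open>q\<close> share at an index \<open>i\<close> moves from \<open>f i\<close> to \<open>g i\<close>, by less than \<open>e\<close>, and the rest of the mass
  is at most the \<open>\<ell>\<^sup>1\<close> distance of the weights. An index that carries mass for only one of
  \<open>p\<close> and \<open>q\<close> counts entirely towards the rest, so that \<open>f\<close> and \<open>g\<close> need not be close there.\<close>

lemma prob_map_pmf_le_enlargement:
  assumes f: "f ` set_pmf p \<subseteq> mspace Z" and g: "g ` set_pmf q \<subseteq> mspace Z"
    and near: "\<And>i. i \<in> set_pmf p \<Longrightarrow> i \<in> set_pmf q \<Longrightarrow> mdist Z (f i) (g i) < e"
    and I: "finite I" "set_pmf p \<subseteq> I" "set_pmf q \<subseteq> I"
    and weights: "(\<Sum>i\<in>I. \<bar>pmf p i - pmf q i\<bar>) \<le> e"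
  shows "measure_pmf.prob (map_pmf f p) A
    \<le> measure_pmf.prob (map_pmf g q) (enlargement Z A e) + e"
proof -
  define B where "B = {i \<in> set_pmf p. f i \<in> A}"
  have fin: "finite B" "B \<subseteq> I" using I by (auto simp: B_def intro: finite_subset)
  have "measure_pmf.prob (map_pmf f p) A = measure_pmf.prob p (f -` A \<inter> set_pmf p)"
    by (simp add: measure_Int_set_pmf)
  also have "f -` A \<inter> set_pmf p = B" by (auto simp: B_def)
  also have "measure_pmf.prob p B = (\<Sum>i\<in>B. pmf p i)"
    using fin by (simp add: measure_measure_pmf_finite)
  also have "\<dots> \<le> (\<Sum>i\<in>B. pmf q i + \<bar>pmf p i - pmf q i\<bar>)"
    by (intro sum_mono) auto
  also have "\<dots> = (\<Sum>i\<in>B. pmf q i) + (\<Sum>i\<in>B. \<bar>pmf p i - pmf q i\<bar>)"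
    by (rule sum.distrib)
  also have "(\<Sum>i\<in>B. \<bar>pmf p i - pmf q i\<bar>) \<le> e"
    using sum_mono2 [OF I(1) fin(2), of "\<lambda>i. \<bar>pmf p i - pmf q i\<bar>"] weights by simp
  also have "(\<Sum>i\<in>B. pmf q i) = measure_pmf.prob q (B \<inter> set_pmf q)"
    using fin by (simp add: measure_measure_pmf_finite measure_Int_set_pmf)
  also have "\<dots> \<le> measure_pmf.prob q (g -` enlargement Z A e)"
    using f g near
    by (intro measure_pmf.finite_measure_mono) (fastforce simp: B_def in_enlargement_iff)+
  finally show ?thesis by simp
qed

lemma levy_prokhorov_map_pmf_le:
  assumes "e > 0" and "f ` set_pmf p \<subseteq> mspace Z" "g ` set_pmf q \<subseteq> mspace Z"
    and "\<And>i. i \<in> set_pmf p \<Longrightarrow> i \<in> set_pmf q \<Longrightarrow> mdist Z (f i) (g i) < e"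
    and "finite I" "set_pmf p \<subseteq> I" "set_pmf q \<subseteq> I"
    and "(\<Sum>i\<in>I. \<bar>pmf p i - pmf q i\<bar>) \<le> e"
  shows "levy_prokhorov Z (map_pmf f p) (map_pmf g q) \<le> e"
  using assms
  by (intro levy_prokhorov_le prob_map_pmf_le_enlargement [where I = I])
    (auto simp: mdist_commute abs_minus_commute)

text \<open>The admissibility of \<open>e\<close> for \<open>\<mu>\<close> and \<open>\<nu>\<close> is tested on the part of \<open>h -` A\<close> in the support
  of \<open>\<mu>\<close>. It has the same mass and is finite, hence a Borel set whatever \<open>A\<close> and \<open>h\<close> are.\<close>

lemma prob_map_pmf_nonexpansive:
  assumes h: "\<And>a. a \<in> mspace Z \<Longrightarrow> h a \<in> mspace Z'"
      "\<And>a b. a \<in> mspace Z \<Longrightarrow> b \<in> mspace Z \<Longrightarrow> mdist Z' (h a) (h b) \<le> mdist Z a b"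
    and \<mu>: "finite (set_pmf \<mu>)" "set_pmf \<mu> \<subseteq> mspace Z"
    and e: "\<And>A. A \<in> borel_sets_of (mtopology_of Z) \<Longrightarrow>
      measure_pmf.prob \<mu> A \<le> measure_pmf.prob \<nu> (enlargement Z A e) + e"
  shows "measure_pmf.prob (map_pmf h \<mu>) A
    \<le> measure_pmf.prob (map_pmf h \<nu>) (enlargement Z' A e) + e"
proof -
  define B where "B = h -` A \<inter> set_pmf \<mu>"
  have B: "B \<in> borel_sets_of (mtopology_of Z)"
    using \<mu> by (intro finite_in_borel_sets_of) (auto simp: B_def)
  have "enlargement Z B e \<subseteq> h -` enlargement Z' A e"
  proof
    fix b assume "b \<in> enlargement Z B e"
    then obtain a where a: "h a \<in> A" "a \<in> mspace Z" "b \<in> mspace Z" "mdist Z a b < e"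
      by (auto simp: in_enlargement_iff B_def)
    then have "mdist Z' (h a) (h b) < e" using h(2) [of a b] by linarith
    then show "b \<in> h -` enlargement Z' A e" using a h(1) by (auto simp: in_enlargement_iff)
  qed
  then have "measure_pmf.prob \<nu> (enlargement Z B e)
      \<le> measure_pmf.prob \<nu> (h -` enlargement Z' A e)"
    by (intro measure_pmf.finite_measure_mono) auto
  moreover have "measure_pmf.prob (map_pmf h \<mu>) A = measure_pmf.prob \<mu> B"
    by (simp add: measure_Int_set_pmf B_def)
  ultimately show ?thesis using e [OF B] by simp
qed

lemma levy_prokhorov_map_pmf_nonexpansive:
  assumes h: "\<And>a. a \<in> mspace Z \<Longrightarrow> h a \<in> mspace Z'"
      "\<And>a b. a \<in> mspace Z \<Longrightarrow> b \<in> mspace Z \<Longrightarrow> mdist Z' (h a) (h b) \<le> mdist Z a b"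
    and \<mu>: "\<mu> \<in> fin_measures n Z" and \<nu>: "\<nu> \<in> fin_measures n Z"
  shows "levy_prokhorov Z' (map_pmf h \<mu>) (map_pmf h \<nu>) \<le> levy_prokhorov Z \<mu> \<nu>"
proof -
  have fin: "finite (set_pmf \<mu>)" "set_pmf \<mu> \<subseteq> mspace Z"
      "finite (set_pmf \<nu>)" "set_pmf \<nu> \<subseteq> mspace Z"
    using \<mu> \<nu> by (auto simp: fin_measures_def)
  let ?adm = "\<lambda>Z \<mu> \<nu>. {e. e > 0 \<and> (\<forall>A \<in> borel_sets_of (mtopology_of Z).
            measure_pmf.prob \<mu> A \<le> measure_pmf.prob \<nu> (enlargement Z A e) + e \<and>
            measure_pmf.prob \<nu> A \<le> measure_pmf.prob \<mu> (enlargement Z A e) + e)}"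
  have "Inf (?adm Z' (map_pmf h \<mu>) (map_pmf h \<nu>)) \<le> Inf (?adm Z \<mu> \<nu>)"
  proof (rule cInf_superset_mono)
    have "1 \<in> ?adm Z \<mu> \<nu>" by (auto intro: order_trans [OF measure_pmf.prob_le_1])
    then show "?adm Z \<mu> \<nu> \<noteq> {}" by blast
    show "bdd_below (?adm Z' (map_pmf h \<mu>) (map_pmf h \<nu>))"
      by (rule bdd_belowI [of _ 0]) auto
    show "?adm Z \<mu> \<nu> \<subseteq> ?adm Z' (map_pmf h \<mu>) (map_pmf h \<nu>)"
    proof (intro subsetI CollectI conjI ballI)
      fix e A assume e: "e \<in> ?adm Z \<mu> \<nu>"
      then show "e > 0" by blast
      show "measure_pmf.prob (map_pmf h \<mu>) A
          \<le> measure_pmf.prob (map_pmf h \<nu>) (enlargement Z' A e) + e"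
        by (rule prob_map_pmf_nonexpansive [OF h fin(1,2)]) (use e in auto)
      show "measure_pmf.prob (map_pmf h \<nu>) A
          \<le> measure_pmf.prob (map_pmf h \<mu>) (enlargement Z' A e) + e"
        by (rule prob_map_pmf_nonexpansive [OF h fin(3,4)]) (use e in auto)
    qed
  qed
  then show ?thesis by (simp only: levy_prokhorov_def)
qed

section \<open>Continuous families of finite convex combinations\<close>

lemma continuous_map_mtopology_of_iff:
  "continuous_map X (mtopology_of Z) f \<longleftrightarrow>
    (\<forall>x \<in> topspace X. \<forall>e>0. \<exists>U. openin X U \<and> x \<in> U \<and>
      (\<forall>y\<in>U. f x \<in> mspace Z \<and> f y \<in> mspace Z \<and> mdist Z (f x) (f y) < e))"
proof -
  interpret Z: Metric_space "mspace Z" "mdist Z" by simp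
  show ?thesis
    unfolding mtopology_of_def Z.continuous_map_to_metric by simp
qed

text \<open>A finite family of maps \<open>s i\<close>, each continuous on an open set \<open>V i\<close> only, is averaged with
  continuous weights that vanish off \<open>V i\<close>. Near a point \<open>x\<close>, the maps with positive
  weight at \<open>x\<close> are defined and vary little, while the weights of all other maps stay small.\<close>

lemma continuous_map_mixture:
  fixes W :: "'x \<Rightarrow> 'i pmf" and s :: "'i \<Rightarrow> 'x \<Rightarrow> 'z"
  assumes I: "finite I" "card I \<le> n"
    and W: "\<And>x. x \<in> topspace X \<Longrightarrow> set_pmf (W x) \<subseteq> I"
      "\<And>i. i \<in> I \<Longrightarrow> continuous_map X euclideanreal (\<lambda>x. pmf (W x) i)"
    and V: "\<And>i. i \<in> I \<Longrightarrow> openin X (V i)"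
      "\<And>x i. x \<in> topspace X \<Longrightarrow> i \<in> set_pmf (W x) \<Longrightarrow> x \<in> V i"
    and s: "\<And>i. i \<in> I \<Longrightarrow> continuous_map (subtopology X (V i)) (mtopology_of Z) (s i)"
  shows "continuous_map X (mtopology_of (fin_measure_space n Z)) (\<lambda>x. map_pmf (\<lambda>i. s i x) (W x))"
  unfolding continuous_map_mtopology_of_iff
proof (intro ballI allI impI)
  fix x and e :: real
  assume x: "x \<in> topspace X" and e: "e > 0"
  have s_in: "s i y \<in> mspace Z" if "y \<in> topspace X" "i \<in> set_pmf (W y)" for i y
  proof -
    have "i \<in> I" "y \<in> V i" using W V that by blast+
    then show ?thesis
      using continuous_map_image_subset_topspace [OF s [of i]] that by fastforce
  qed
  have mem: "map_pmf (\<lambda>i. s i y) (W y) \<in> fin_measures n Z" if y: "y \<in> topspace X" for y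
  proof -
    have "finite (set_pmf (W y))" "card (set_pmf (W y)) \<le> n"
      using W(1) [OF y] I card_mono [of I "set_pmf (W y)"] by (auto intro: finite_subset)
    then show ?thesis
      using s_in [OF y] card_image_le [of "set_pmf (W y)" "\<lambda>i. s i y"]
      by (auto simp: fin_measures_def)
  qed
  \<comment> \<open>The bound on the change of a single weight: \<open>card I\<close> such changes add up to at most \<open>e / 2\<close>.
    The summand 1 only serves to avoid a division by zero.\<close>
  define d where "d = e / 2 / (card I + 1)"
  have d: "d > 0" "card I * d \<le> e / 2"
    using e by (auto simp: d_def field_simps)
  have "\<exists>U. openin X U \<and> x \<in> U \<and> (\<forall>y\<in>U. \<bar>pmf (W x) i - pmf (W y) i\<bar> < d \<and>
      (i \<in> set_pmf (W x) \<longrightarrow> mdist Z (s i x) (s i y) < e / 2))" if i: "i \<in> I" for i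
  proof -
    have "continuous_map X (mtopology_of euclidean_metric) (\<lambda>x. pmf (W x) i)"
      using W(2) [OF i] by simp
    then obtain U where U: "openin X U" "x \<in> U" "\<And>y. y \<in> U \<Longrightarrow> \<bar>pmf (W x) i - pmf (W y) i\<bar> < d"
      unfolding continuous_map_mtopology_of_iff using x d by (auto simp: dist_real_def) metis
    show ?thesis
    proof (cases "i \<in> set_pmf (W x)")
      case True
      then have "x \<in> topspace (subtopology X (V i))" using x V by auto
      then obtain U' where U': "openin (subtopology X (V i)) U'" "x \<in> U'"
        "\<And>y. y \<in> U' \<Longrightarrow> mdist Z (s i x) (s i y) < e / 2"
        using s [OF i] e unfolding continuous_map_mtopology_of_iff by (meson half_gt_zero)
      \<comment> \<open>Here it matters that \<open>V i\<close> is open.\<close>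
      then have "openin X U'" using V(1) [OF i] openin_trans_full by blast
      then show ?thesis using U U' by (intro exI [of _ "U \<inter> U'"]) auto
    qed (use U in blast)
  qed
  then obtain U where U: "\<And>i. i \<in> I \<Longrightarrow> openin X (U i)" "\<And>i. i \<in> I \<Longrightarrow> x \<in> U i"
    "\<And>i y. i \<in> I \<Longrightarrow> y \<in> U i \<Longrightarrow> \<bar>pmf (W x) i - pmf (W y) i\<bar> < d"
    "\<And>i y. i \<in> I \<Longrightarrow> y \<in> U i \<Longrightarrow> i \<in> set_pmf (W x) \<Longrightarrow> mdist Z (s i x) (s i y) < e / 2"
    by metis
  define N where "N = topspace X \<inter> (\<Inter>i\<in>I. U i)"
  have "openin X N" unfolding N_def
    using I U(1) by (cases "I = {}") (auto intro!: openin_Int openin_INT2)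
  moreover have "x \<in> N" using U(2) x by (auto simp: N_def)
  moreover have "levy_prokhorov Z (map_pmf (\<lambda>i. s i x) (W x)) (map_pmf (\<lambda>i. s i y) (W y)) < e"
    if y: "y \<in> N" for y
  proof -
    have yX: "y \<in> topspace X" using y by (simp add: N_def)
    have "(\<Sum>i\<in>I. \<bar>pmf (W x) i - pmf (W y) i\<bar>) \<le> card I * d"
      using U(3) y by (intro sum_bounded_above) (force simp: N_def)
    also have "\<dots> \<le> e / 2" by (rule d)
    finally have sm: "(\<Sum>i\<in>I. \<bar>pmf (W x) i - pmf (W y) i\<bar>) \<le> e / 2" .
    have "mdist Z (s i x) (s i y) < e / 2" if "i \<in> set_pmf (W x)" for i
      using U(4) W(1) [OF x] that y by (auto simp: N_def)
    then have "levy_prokhorov Z (map_pmf (\<lambda>i. s i x) (W x)) (map_pmf (\<lambda>i. s i y) (W y)) \<le> e / 2"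
      using e s_in x yX W(1) I sm
      by (intro levy_prokhorov_map_pmf_le [where I = I]) auto
    then show ?thesis using e by simp
  qed
  ultimately show "\<exists>U. openin X U \<and> x \<in> U \<and> (\<forall>y\<in>U.
      map_pmf (\<lambda>i. s i x) (W x) \<in> mspace (fin_measure_space n Z) \<and>
      map_pmf (\<lambda>i. s i y) (W y) \<in> mspace (fin_measure_space n Z) \<and>
      mdist (fin_measure_space n Z) (map_pmf (\<lambda>i. s i x) (W x)) (map_pmf (\<lambda>i. s i y) (W y)) < e)"
    using mem x by (intro exI [of _ N]) (auto simp: N_def)
qed

section \<open>Resolving a measure on the path space\<close>

lemma compactin_unit_interval: "compactin (top_of_set {0..1::real}) (topspace (top_of_set {0..1}))"
  by (simp add: compactin_subtopology)

lemma mspace_path_metric: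
  "mspace (path_metric X) = topspace (path_space (mtopology_of X))"
  by (metis mtopology_of_path_metric topspace_mtopology_of)

lemma path_metric_eval:
  assumes "t \<in> {0..1}" "\<alpha> \<in> mspace (path_metric X)"
  shows "\<alpha> t \<in> mspace X"
  using assms unfolding path_metric_def compactin_mspace_cfunspace [OF compactin_unit_interval] by auto

text \<open>A resolved path is an average of the paths in the support of the measure, with weights that do
  not depend on time.\<close>

lemma resolve_in_path_metric:
  assumes \<mu>: "\<mu> \<in> fin_measures n (path_metric X)"
  shows "resolve \<mu> \<in> mspace (path_metric (fin_measure_space n X))"
proof -
  have "continuous_map (top_of_set {0..1}) (mtopology_of (fin_measure_space n X))
      (\<lambda>t. map_pmf (\<lambda>\<alpha>. \<alpha> t) \<mu>)"
  proof (rule continuous_map_mixture)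
    show "finite (set_pmf \<mu>)" "card (set_pmf \<mu>) \<le> n" using \<mu> by (auto simp: fin_measures_def)
    show "openin (top_of_set {0..1}) {0..1::real}" by simp
    fix \<alpha> assume "\<alpha> \<in> set_pmf \<mu>"
    then have "\<alpha> \<in> topspace (path_space (mtopology_of X))"
      using \<mu> by (auto simp: fin_measures_def mspace_path_metric)
    then show "continuous_map (subtopology (top_of_set {0..1}) {0..1}) (mtopology_of X) \<alpha>"
      by (simp add: path_space_def subtopology_subtopology)
  qed auto
  then have "continuous_map (top_of_set {0..1}) (mtopology_of (fin_measure_space n X)) (resolve \<mu>)"
    by (rule continuous_map_eq) (simp add: resolve_def)
  then show ?thesis
    by (simp add: mspace_path_metric path_space_def) (simp add: resolve_def)
qed

text \<open>Evaluation at any time is nonexpansive for the supremum metric on the paths in \<open>X\<close>; the supremum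
  over all times of the resulting estimates is a bound in the path space of the measures.\<close>

lemma resolve_nonexpansive:
  assumes \<mu>: "\<mu> \<in> fin_measures n (path_metric X)" and \<nu>: "\<nu> \<in> fin_measures n (path_metric X)"
  shows "mdist (path_metric (fin_measure_space n X)) (resolve \<mu>) (resolve \<nu>)
    \<le> levy_prokhorov (path_metric X) \<mu> \<nu>"
  unfolding path_metric_def [of "fin_measure_space n X"]
proof (rule mdist_cfunspace_le)
  show "0 \<le> levy_prokhorov (path_metric X) \<mu> \<nu>"
    using mdist_nonneg [of "fin_measure_space n (path_metric X)" \<mu> \<nu>] by simp
  fix t :: real assume "t \<in> topspace (top_of_set {0..1})"
  then have t: "t \<in> {0..1}" by simp
  have "levy_prokhorov X (map_pmf (\<lambda>\<alpha>. \<alpha> t) \<mu>) (map_pmf (\<lambda>\<alpha>. \<alpha> t) \<nu>)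
      \<le> levy_prokhorov (path_metric X) \<mu> \<nu>"
  proof (rule levy_prokhorov_map_pmf_nonexpansive [OF path_metric_eval [OF t] _ \<mu> \<nu>])
    fix \<alpha> \<beta> assume "\<alpha> \<in> mspace (path_metric X)" "\<beta> \<in> mspace (path_metric X)"
    then show "mdist X (\<alpha> t) (\<beta> t) \<le> mdist (path_metric X) \<alpha> \<beta>"
      using cfunspace_mdist_le [of \<alpha> "top_of_set {0..1}" X \<beta> "mdist (path_metric X) \<alpha> \<beta>"] t
      unfolding path_metric_def by fastforce
  qed
  then show "mdist (fin_measure_space n X) (resolve \<mu> t) (resolve \<nu> t)
      \<le> levy_prokhorov (path_metric X) \<mu> \<nu>"
    using t by (simp add: resolve_def)
qed

lemma continuous_map_resolve:
  "continuous_map (mtopology_of (fin_measure_space n (path_metric X)))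
     (resolvable_path_space n X) resolve"
proof -
  have "Lipschitz_continuous_map (fin_measure_space n (path_metric X))
      (path_metric (fin_measure_space n X)) resolve"
    unfolding Lipschitz_continuous_map_def
    using resolve_in_path_metric resolve_nonexpansive
    by (intro conjI exI [of _ 1]) auto
  then have "continuous_map (mtopology_of (fin_measure_space n (path_metric X)))
      (path_space (mtopology_of (fin_measure_space n X))) resolve"
    using Lipschitz_continuous_imp_continuous_map by (metis mtopology_of_path_metric)
  moreover have "resolve \<mu> \<in> resolvable_paths n X" if "\<mu> \<in> fin_measures n (path_metric X)" for \<mu>
    using resolve_in_path_metric [OF that] that
    unfolding resolvable_paths_def mspace_path_metric by auto
  ultimately show ?thesis
    unfolding resolvable_path_space_def
    by (auto simp: continuous_map_in_subtopology)
qed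

section \<open>Partitions of unity\<close>

text \<open>The function is the distance to the complement of \<open>U\<close>, truncated at 1 so that it also makes
  sense for \<open>U\<close> the whole space.\<close>

lemma metrizable_space_open_cozero:
  assumes "metrizable_space X" and "openin X U"
  obtains f where "continuous_map X euclideanreal f"
    "\<And>x. x \<in> topspace X \<Longrightarrow> 0 \<le> f x"
    "\<And>x. x \<in> topspace X \<Longrightarrow> 0 < f x \<longleftrightarrow> x \<in> U"
proof -
  obtain M d where "Metric_space M d" and X: "X = Metric_space.mtopology M d"
    using assms(1) unfolding metrizable_space_def by blast
  then interpret Metric_space M d by simp
  define f where "f x = Inf (insert 1 (d x ` (M - U)))" for x
  have bdd: "bdd_below (insert 1 (d x ` (M - U)))" for x
    by (rule bdd_belowI [of _ 0]) auto
  have le1: "f x \<le> 1" and led: "c \<in> M - U \<Longrightarrow> f x \<le> d x c" for x c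
    unfolding f_def using bdd by (auto intro!: cInf_lower)
  have f_nonneg: "0 \<le> f x" for x
    unfolding f_def by (rule cInf_greatest) auto
  have lip: "f x - d x y \<le> f y" if "x \<in> M" "y \<in> M" for x y
    unfolding f_def [of y]
  proof (rule cInf_greatest)
    fix r assume "r \<in> insert 1 (d y ` (M - U))"
    then consider "r = 1" | c where "c \<in> M - U" "r = d y c" by blast
    then show "f x - d x y \<le> r"
    proof cases
      case 1
      then show ?thesis using le1 [of x] nonneg [of x y] by linarith
    next
      case 2
      then have "f x \<le> d x c" "d x c \<le> d x y + d y c"
        using led triangle that by blast+
      then show ?thesis using \<open>r = d y c\<close> by linarith
    qed
  qed auto
  have "Lipschitz_continuous_map (metric (M, d)) euclidean_metric f"
    unfolding Lipschitz_continuous_map_def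
  proof (intro conjI exI [of _ 1] ballI)
    fix x y assume "x \<in> mspace (metric (M, d))" "y \<in> mspace (metric (M, d))"
    then show "mdist euclidean_metric (f x) (f y) \<le> 1 * mdist (metric (M, d)) x y"
      using lip [of x y] lip [of y x] by (simp add: commute dist_real_def abs_le_iff)
  qed simp
  then have "continuous_map X euclideanreal f"
    using Lipschitz_continuous_imp_continuous_map X by (metis mtopology_of mtopology_of_euclidean)
  moreover have "0 < f x \<longleftrightarrow> x \<in> U" if x: "x \<in> topspace X" for x
  proof
    assume "0 < f x"
    then show "x \<in> U" using led [of x x] x X by (cases "x \<in> U") auto
  next
    assume "x \<in> U"
    then obtain r where r: "r > 0" "mball x r \<subseteq> U"
      using assms(2) X openin_mtopology by blast
    have "min 1 r \<le> f x"
      unfolding f_def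
    proof (rule cInf_greatest)
      fix e assume "e \<in> insert 1 (d x ` (M - U))"
      then show "min 1 r \<le> e" using r x X by (force simp: subset_iff not_less)
    qed auto
    then show "0 < f x" using r by linarith
  qed
  ultimately show thesis using f_nonneg that by blast
qed

text \<open>The functions of the preceding lemma are normalised by their sum, which is positive because
  the sets cover. The values at a point are bundled into a probability measure
  on the index set, in the form that \<open>continuous_map_mixture\<close> uses.\<close>

lemma metrizable_space_partition_of_unity:
  fixes V :: "'i \<Rightarrow> 'x set"
  assumes X: "metrizable_space X" and I: "finite I"
    and V: "\<And>i. i \<in> I \<Longrightarrow> openin X (V i)" "topspace X \<subseteq> (\<Union>i\<in>I. V i)"
  obtains W :: "'x \<Rightarrow> 'i pmf"
  where "\<And>i. continuous_map X euclideanreal (\<lambda>x. pmf (W x) i)"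
    and "\<And>x. x \<in> topspace X \<Longrightarrow> set_pmf (W x) = {i \<in> I. x \<in> V i}"
proof -
  have "\<forall>i\<in>I. \<exists>f. continuous_map X euclideanreal f \<and>
      (\<forall>x\<in>topspace X. 0 \<le> f x \<and> (0 < f x \<longleftrightarrow> x \<in> V i))"
    using metrizable_space_open_cozero [OF X V(1)] by metis
  then obtain f where f: "\<And>i. i \<in> I \<Longrightarrow> continuous_map X euclideanreal (f i)"
    "\<And>i x. i \<in> I \<Longrightarrow> x \<in> topspace X \<Longrightarrow> 0 \<le> f i x"
    "\<And>i x. i \<in> I \<Longrightarrow> x \<in> topspace X \<Longrightarrow> 0 < f i x \<longleftrightarrow> x \<in> V i"
    by metis
  define w where "w x i = (if i \<in> I then f i x / (\<Sum>j\<in>I. f j x) else 0)" for x i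
  have sum_pos: "(\<Sum>j\<in>I. f j x) > 0" if x: "x \<in> topspace X" for x
  proof -
    obtain i where "i \<in> I" "x \<in> V i" using x V by blast
    then show ?thesis using f x I by (intro sum_pos2 [of I i]) auto
  qed
  have w_nonneg: "0 \<le> w x i" if x: "x \<in> topspace X" for x i
    using f x sum_pos [OF x] by (simp add: w_def)
  have "(\<integral>\<^sup>+i. ennreal (w x i) \<partial>count_space UNIV) = 1" if x: "x \<in> topspace X" for x
  proof -
    have "(\<integral>\<^sup>+i. ennreal (w x i) \<partial>count_space UNIV) = (\<Sum>i\<in>I. ennreal (w x i))"
      using I by (intro nn_integral_count_space') (auto simp: w_def)
    also have "\<dots> = ennreal (\<Sum>i\<in>I. w x i)"
      using w_nonneg [OF x] by (simp add: sum_ennreal)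
    also have "(\<Sum>i\<in>I. w x i) = 1"
      using sum_pos [OF x] by (simp add: w_def flip: sum_divide_distrib)
    finally show ?thesis by simp
  qed
  then have pmf_w: "pmf (embed_pmf (w x)) i = w x i" if "x \<in> topspace X" for x i
    using w_nonneg that by (intro pmf_embed_pmf) auto
  show thesis
  proof
    show "continuous_map X euclideanreal (\<lambda>x. pmf (embed_pmf (w x)) i)" for i
    proof (rule continuous_map_eq)
      have "continuous_map X euclideanreal (\<lambda>x. f i x / (\<Sum>j\<in>I. f j x))" if "i \<in> I"
        using that I f(1) sum_pos
        by (intro continuous_map_real_divide continuous_map_sum) (auto simp: less_imp_neq [symmetric])
      then show "continuous_map X euclideanreal (\<lambda>x. w x i)"
        by (cases "i \<in> I") (simp_all add: w_def)
    qed (simp add: pmf_w)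
    show "set_pmf (embed_pmf (w x)) = {i \<in> I. x \<in> V i}" if x: "x \<in> topspace X" for x
    proof -
      have "0 < w x i \<longleftrightarrow> i \<in> I \<and> x \<in> V i" for i
        using f(3) x sum_pos [OF x] by (auto simp: w_def zero_less_divide_iff)
      moreover have "i \<in> set_pmf (embed_pmf (w x)) \<longleftrightarrow> 0 < w x i" for i
        using w_nonneg [OF x, of i] pmf_w [OF x, of i] by (auto simp: set_pmf_iff)
      ultimately show ?thesis by blast
    qed
  qed
qed

section \<open>Comparison of the invariants\<close>

lemma stop_time_in_unit_interval:
  assumes "m \<ge> 2" "i \<in> {1..m}"
  shows "stop_time m i \<in> {0..1}"
  using assms by (auto simp: stop_time_def divide_simps)

text \<open>Composition with \<open>\<Phi>\<close> turns a section for \<open>dTC\<close> into one for \<open>iTC\<close>. Since \<open>\<alpha>(t\<^sub>i) = x\<^sub>i\<close> for all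
  \<open>\<alpha>\<close> in the support of the measure, evaluation at \<open>t\<^sub>i\<close> is constant there and pushes the
  measure forward to a Dirac measure.\<close>

lemma iTC_le_dTC:
  assumes m: "m \<ge> 2"
  shows "iTC m X \<le> dTC m X"
  unfolding iTC_def dTC_def
proof (rule Inf_superset_mono, clarify, intro exI conjI ballI)
  fix n s
  assume s: "continuous_map (power_space m (mtopology_of X))
      (mtopology_of (fin_measure_space (n + 1) (path_metric X))) s"
    and through: "\<forall>x \<in> topspace (power_space m (mtopology_of X)).
      s x \<in> mspace (fin_measure_space (n + 1) (submetric (path_metric X) (paths_through m X x)))"
  show "continuous_map (power_space m (mtopology_of X)) (resolvable_path_space (n + 1) X) (resolve \<circ> s)"
    by (rule continuous_map_compose [OF s continuous_map_resolve])
  fix x i assume x: "x \<in> topspace (power_space m (mtopology_of X))" and i: "i \<in> {1..m}"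
  have "set_pmf (s x) \<subseteq> paths_through m X x"
    using through x by (simp add: fin_measures_def)
  then have "map_pmf (\<lambda>\<alpha>. \<alpha> (stop_time m i)) (s x) = map_pmf (\<lambda>_. x i) (s x)"
    using i by (intro map_pmf_cong) (auto simp: paths_through_def)
  then show "(resolve \<circ> s) x (stop_time m i) = return_pmf (x i)"
    using stop_time_in_unit_interval [OF m i] by (simp add: resolve_def map_pmf_const)
qed simp

lemma metrizable_power_space:
  assumes "metrizable_space X"
  shows "metrizable_space (power_space m X)"
  using assms unfolding power_space_def metrizable_space_product_topology
  by (auto intro!: countable_finite)

text \<open>The \<open>n + 1\<close> local sections are averaged with a partition of unity. Only the sections
  defined at \<open>x\<close> occur at \<open>x\<close>, so that the measure is supported on at most \<open>n + 1\<close> paths through \<open>x\<close>.\<close>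

lemma dTC_le_TC: "dTC m X \<le> TC m (mtopology_of X)"
  unfolding dTC_def TC_def
proof (rule Inf_superset_mono, clarify)
  fix n and V :: "nat \<Rightarrow> (nat \<Rightarrow> 'a) set"
  let ?P = "power_space m (mtopology_of X)"
  assume V: "\<forall>i\<le>n. openin ?P (V i)" "topspace ?P = (\<Union>i\<le>n. V i)"
    and "\<forall>i\<le>n. \<exists>s. continuous_map (subtopology ?P (V i)) (path_space (mtopology_of X)) s \<and>
        (\<forall>x \<in> V i. \<forall>j\<in>{1..m}. s x (stop_time m j) = x j)"
  then obtain s where s: "\<And>i. i \<le> n \<Longrightarrow>
      continuous_map (subtopology ?P (V i)) (path_space (mtopology_of X)) (s i)"
    "\<And>i x j. i \<le> n \<Longrightarrow> x \<in> V i \<Longrightarrow> j \<in> {1..m} \<Longrightarrow> s i x (stop_time m j) = x j"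
    by metis
  have "metrizable_space ?P"
    using Metric_space.metrizable_space_mtopology [OF Metric_space_mspace_mdist]
    by (intro metrizable_power_space) (simp add: mtopology_of_def)
  then obtain W :: "(nat \<Rightarrow> 'a) \<Rightarrow> nat pmf"
    where W: "\<And>i. continuous_map ?P euclideanreal (\<lambda>x. pmf (W x) i)"
      "\<And>x. x \<in> topspace ?P \<Longrightarrow> set_pmf (W x) = {i \<in> {..n}. x \<in> V i}"
    using metrizable_space_partition_of_unity [of ?P "{..n}" V] V by auto
  define S where "S x = map_pmf (\<lambda>i. s i x) (W x)" for x
  have S: "continuous_map ?P (mtopology_of (fin_measure_space (n + 1) (path_metric X))) S"
    unfolding S_def
    by (rule continuous_map_mixture [where I = "{..n}" and V = V])
      (use V s(1) W in \<open>auto simp: mtopology_of_path_metric\<close>)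
  moreover have "S x \<in> mspace (fin_measure_space (n + 1) (submetric (path_metric X) (paths_through m X x)))"
    if x: "x \<in> topspace ?P" for x
  proof -
    have "S x \<in> fin_measures (n + 1) (path_metric X)"
      using continuous_map_image_subset_topspace [OF S] x by auto
    moreover have "\<gamma> \<in> paths_through m X x" if \<gamma>: "\<gamma> \<in> set_pmf (S x)" for \<gamma>
    proof -
      have "\<gamma> \<in> topspace (path_space (mtopology_of X))"
        using calculation \<gamma> by (auto simp: fin_measures_def mspace_path_metric)
      moreover obtain i where "i \<le> n" "x \<in> V i" "\<gamma> = s i x"
        using \<gamma> W(2) [OF x] by (auto simp: S_def)
      ultimately show ?thesis using s(2) by (simp add: paths_through_def)
    qed
    ultimately show ?thesis by (auto simp: fin_measures_def)
  qed
  ultimately show "\<exists>k. enat n = enat k \<and> (\<exists>s.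
      continuous_map ?P (mtopology_of (fin_measure_space (k + 1) (path_metric X))) s \<and>
      (\<forall>x \<in> topspace ?P.
        s x \<in> mspace (fin_measure_space (k + 1) (submetric (path_metric X) (paths_through m X x)))))"
    by blast
qed

theorem proposition4p6:
  fixes X :: "'a metric" and m :: nat
  assumes "m \<ge> 2"
    and "path_connected_space (mtopology_of X)"
    and "ANR_space (mtopology_of X)"
  shows "iTC m X \<le> dTC m X \<and> dTC m X \<le> TC m (mtopology_of X)"
  using iTC_le_dTC [OF assms(1)] dTC_le_TC by blast

end
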